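(* Let $k\ge 2$. For the star $K_{1,k}$ we have $$\mathrm{st}(n,K_{1,k})=\begin{cases}\lfloor n^2/4\rfloor=\mathrm{ex}(n,K_3) & \text{for all } n\ge 2k-1,\ n\ge k+1,\\ \lfloor (k-1)n/2\rfloor & \text{if } k+1\le n\le 2k-2.\end{cases}$$
   Context: Graphs are finite and simple; $K_{1,k}$ is the star with $k$ leaves. $\mathrm{ex}(n,G)$ is the maximum number of edges of a graph on $n$ vertices containing no (not necessarily induced) copy of $G$. For a non-complete graph $G$ on $r$ vertices and $n\ge r$, $\mathrm{st}(n,G)$ is the largest $m$ for which there is a graph $H$ with $n$ vertices and $m$ edges such that no subgraph $F\subseteq H$ on exactly $r$ vertices contains $G$ as a proper subgraph. *)

theory Defs
  imports Main "HOL-Library.Ramsey"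
begin

datatype 'a ugraph = UGraph (verts: "'a set") (edges: "'a set set")

(* Finite simple graphs: nsets (verts G) 2 is the set of two-element subsets of verts G. *)
definition simple_graph :: "'a ugraph \<Rightarrow> bool" where
  "simple_graph G \<longleftrightarrow> finite (verts G) \<and> edges G \<subseteq> nsets (verts G) 2"

(* Not necessarily induced or spanning. *)
definition subgraph :: "'a ugraph \<Rightarrow> 'a ugraph \<Rightarrow> bool" where
  "subgraph F H \<longleftrightarrow> simple_graph F \<and> simple_graph H \<and> verts F \<subseteq> verts H \<and> edges F \<subseteq> edges H"

definition graph_iso :: "'a ugraph \<Rightarrow> 'b ugraph \<Rightarrow> bool" where
  "graph_iso G H \<longleftrightarrow> (\<exists>f. bij_betw f (verts G) (verts H) \<and> (\<lambda>e. f ` e) ` edges G = edges H)"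

definition contains_copy :: "'a ugraph \<Rightarrow> 'b ugraph \<Rightarrow> bool" where
  "contains_copy H G \<longleftrightarrow> (\<exists>G'. subgraph G' H \<and> graph_iso G G')"

definition contains_copy_properly :: "'a ugraph \<Rightarrow> 'b ugraph \<Rightarrow> bool" where
  "contains_copy_properly F G \<longleftrightarrow> (\<exists>G'. subgraph G' F \<and> G' \<noteq> F \<and> graph_iso G G')"

definition complete_graph :: "nat \<Rightarrow> nat ugraph" where
  "complete_graph r = UGraph {..<r} (nsets {..<r} 2)"

(* The centre is 0 and the leaves are 1, ..., k. *)
definition star :: "nat \<Rightarrow> nat ugraph" where
  "star k = UGraph {0..k} ((\<lambda>i. {0, i}) ` {1..k})"

(* Host graphs have natural-number vertices; every finite graph is isomorphic to one of these.
   In both definitions below, the set under Max is finite, since a simple graph on n vertices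
   has at most n choose 2 edges. It contains 0 (the edgeless graph on n vertices), for
   ex_number provided that this graph contains no copy of G, and for st_number always. *)
definition ex_number :: "nat \<Rightarrow> 'a ugraph \<Rightarrow> nat" where
  "ex_number n G = Max {m. \<exists>H :: nat ugraph.
     simple_graph H \<and> card (verts H) = n \<and> card (edges H) = m \<and> \<not> contains_copy H G}"

(* Intended for non-complete G with card (verts G) \<le> n. *)
definition st_number :: "nat \<Rightarrow> 'a ugraph \<Rightarrow> nat" where
  "st_number n G = Max {m. \<exists>H :: nat ugraph.
     simple_graph H \<and> card (verts H) = n \<and> card (edges H) = m \<and>
     \<not> (\<exists>F. subgraph F H \<and> card (verts F) = card (verts G) \<and> contains_copy_properly F G)}"

end

theory Submission
  imports Defs
begin

text \<open>
  Let \<open>k \<ge> 2\<close>. A graph \<open>H\<close> is admissible for \<open>st_number n (star k)\<close> if and only if every vertex of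
  degree at least \<open>k\<close> has an independent neighbourhood: an edge inside the neighbourhood, together
  with a star of \<open>k\<close> edges whose leaves include both of its ends, is a graph on \<open>k + 1\<close> vertices
  that properly contains the star, and conversely an edge added to a spanning star must join two
  leaves.

  For the upper bound, let \<open>\<Delta>\<close> be the maximum degree. If \<open>\<Delta> \<le> k - 1\<close>, then there are at most
  \<open>(k - 1) n / 2\<close> edges. Otherwise the neighbourhood of a vertex of degree \<open>\<Delta>\<close> is independent, so
  that its complement, which has \<open>n - \<Delta>\<close> elements, meets every edge, and there are at most
  \<open>\<Delta> (n - \<Delta>) \<le> n\<^sup>2 / 4\<close> edges (lemma \<open>edges_bound\<close>). The maximum of the two bounds, rounded
  down, is \<open>\<lfloor>n\<^sup>2 / 4\<rfloor>\<close> for \<open>n \<ge> 2 k - 1\<close> and \<open>\<lfloor>(k - 1) n / 2\<rfloor>\<close> for \<open>n \<le> 2 k - 2\<close>. For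
  \<open>k = 1\<close> the condition on the neighbourhoods says that \<open>H\<close> is triangle-free, and the same
  argument gives Mantel's theorem.

  The first bound is attained by the balanced complete bipartite graph, which has no triangle. The
  second one is attained, for \<open>n \<ge> k + 1\<close>, by a graph of maximum degree at most \<open>k - 1\<close>: a circulant graph if \<open>k - 1\<close>
  is even, and a circulant graph together with a matching of \<open>\<lfloor>n / 2\<rfloor>\<close> edges if \<open>k - 1\<close> is odd
  (lemma \<open>ex_bounded_degree_graph\<close>).
\<close>

section \<open>Neighbourhoods and degrees\<close>

text \<open>The neighbourhood of \<open>v\<close>; for a simple graph, its cardinality is the degree of \<open>v\<close>.\<close>

definition nbrs :: "'a ugraph \<Rightarrow> 'a \<Rightarrow> 'a set" where
  "nbrs H v = {u. {v, u} \<in> edges H}"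

lemma nbrs_iff: "u \<in> nbrs H v \<longleftrightarrow> {v, u} \<in> edges H"
  by (simp add: nbrs_def)

lemma simple_graph_edgeE:
  assumes "simple_graph H" "e \<in> edges H"
  obtains a b where "e = {a, b}" "a \<noteq> b" "a \<in> verts H" "b \<in> verts H"
proof -
  have "e \<subseteq> verts H" "card e = 2"
    using assms by (auto simp: simple_graph_def nsets_def)
  then show thesis
    using that by (auto simp: card_2_iff)
qed

lemma simple_graph_edgeD:
  assumes "simple_graph H" "{a, b} \<in> edges H"
  shows "a \<noteq> b" "a \<in> verts H" "b \<in> verts H"
proof -
  have "{a, b} \<subseteq> verts H" "card {a, b} = 2"
    using assms by (auto simp: simple_graph_def nsets_def)
  then show "a \<noteq> b" "a \<in> verts H" "b \<in> verts H"
    by auto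
qed

lemma simple_graph_finite_edges: "simple_graph H \<Longrightarrow> finite (edges H)"
  unfolding simple_graph_def by (meson finite_imp_finite_nsets finite_subset)

lemma nbrs_subset: "simple_graph H \<Longrightarrow> nbrs H v \<subseteq> verts H"
  by (auto simp: nbrs_iff dest: simple_graph_edgeD)

lemma finite_nbrs: "simple_graph H \<Longrightarrow> finite (nbrs H v)"
  using nbrs_subset finite_subset unfolding simple_graph_def by metis

lemma card_incident_edges:
  assumes "simple_graph H"
  shows "card {e \<in> edges H. v \<in> e} = card (nbrs H v)"
proof -
  have "e \<in> (\<lambda>u. {v, u}) ` nbrs H v" if e: "e \<in> edges H" "v \<in> e" for e
  proof -
    obtain a b where "e = {a, b}"
      using simple_graph_edgeE[OF assms e(1)] by metis
    then have "e = {v, a} \<or> e = {v, b}"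
      using e(2) by auto
    then show ?thesis
      using e(1) by (auto simp: nbrs_iff)
  qed
  then have "{e \<in> edges H. v \<in> e} = (\<lambda>u. {v, u}) ` nbrs H v"
    by (auto simp: nbrs_iff)
  moreover have "inj_on (\<lambda>u. {v, u}) (nbrs H v)"
    by (auto simp: inj_on_def doubleton_eq_iff)
  ultimately show ?thesis
    by (simp add: card_image)
qed

lemma handshake:
  assumes "simple_graph H"
  shows "(\<Sum>v\<in>verts H. card (nbrs H v)) = 2 * card (edges H)"
proof -
  have "card {v \<in> verts H. v \<in> e} = 2" if "e \<in> edges H" for e
  proof -
    have "e \<subseteq> verts H" "card e = 2"
      using assms that by (auto simp: simple_graph_def nsets_def)
    moreover from this have "{v \<in> verts H. v \<in> e} = e" by auto
    ultimately show ?thesis by simp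
  qed
  then have "(\<Sum>v\<in>verts H. card {e \<in> edges H. v \<in> e}) = (\<Sum>e\<in>edges H. 2)"
    using assms simple_graph_finite_edges[OF assms]
    by (intro sum_multicount_gen) (auto simp: simple_graph_def)
  then show ?thesis
    by (simp add: card_incident_edges[OF assms])
qed

lemma card_edges_le_cover:
  assumes "simple_graph H" "finite C" "\<And>e. e \<in> edges H \<Longrightarrow> e \<inter> C \<noteq> {}"
  shows "card (edges H) \<le> (\<Sum>v\<in>C. card (nbrs H v))"
proof -
  have "edges H \<subseteq> (\<Union>v\<in>C. {e \<in> edges H. v \<in> e})"
    using assms(3) by blast
  then have "card (edges H) \<le> card (\<Union>v\<in>C. {e \<in> edges H. v \<in> e})"
    using assms(2) simple_graph_finite_edges[OF assms(1)] by (intro card_mono) auto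
  also have "\<dots> \<le> (\<Sum>v\<in>C. card {e \<in> edges H. v \<in> e})"
    using assms(2) by (rule card_UN_le)
  finally show ?thesis
    by (simp add: card_incident_edges[OF assms(1)])
qed

section \<open>The upper bound\<close>

text \<open>A vertex of degree greater than \<open>d\<close> lies in no triangle. For \<open>d = 0\<close> this says that the
  graph is triangle-free.\<close>

definition high_degree_indep :: "nat \<Rightarrow> 'a ugraph \<Rightarrow> bool" where
  "high_degree_indep d H \<longleftrightarrow>
     (\<forall>v. d < card (nbrs H v) \<longrightarrow> (\<forall>a\<in>nbrs H v. \<forall>b\<in>nbrs H v. {a, b} \<notin> edges H))"

text \<open>The bound on the number \<open>e\<close> of edges is \<open>e \<le> max (n\<^sup>2 / 4) (d n / 2)\<close>, multiplied by 4 to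
  stay in the natural numbers.\<close>

lemma edges_bound:
  assumes H: "simple_graph H" and n: "card (verts H) = n" and d: "high_degree_indep d H"
  shows "4 * card (edges H) \<le> max (n\<^sup>2) (2 * d * n)"
proof (cases "\<exists>v\<in>verts H. d < card (nbrs H v)")
  case False
  then have "(\<Sum>v\<in>verts H. card (nbrs H v)) \<le> card (verts H) * d"
    using sum_bounded_above[of "verts H" "\<lambda>v. card (nbrs H v)" d] by (auto simp: not_less)
  then have "4 * card (edges H) \<le> 2 * d * n"
    by (simp add: handshake[OF H] n mult.commute)
  then show ?thesis
    by (rule max.coboundedI2)
next
  case True
  define \<Delta> where "\<Delta> = Max ((\<lambda>v. card (nbrs H v)) ` verts H)"
  have fin: "finite (verts H)"
    using H by (simp add: simple_graph_def)
  have deg_le: "card (nbrs H v) \<le> \<Delta>" if "v \<in> verts H" for v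
    unfolding \<Delta>_def using fin that by simp
  have "\<Delta> \<in> (\<lambda>v. card (nbrs H v)) ` verts H"
    unfolding \<Delta>_def using fin True by (intro Max_in) auto
  then obtain v where v: "v \<in> verts H" "\<Delta> = card (nbrs H v)"
    by auto
  have "d < card (nbrs H v)"
    using True deg_le v by (auto intro: less_le_trans)
  then have indep: "{a, b} \<notin> edges H" if "a \<in> nbrs H v" "b \<in> nbrs H v" for a b
    using d that unfolding high_degree_indep_def by blast
  \<comment> \<open>As the neighbourhood of \<open>v\<close> is independent, its complement is a vertex cover.\<close>
  let ?C = "verts H - nbrs H v"
  have "e \<inter> ?C \<noteq> {}" if "e \<in> edges H" for e
    using simple_graph_edgeE[OF H that] indep that by (metis Diff_iff Int_iff empty_iff insertCI)
  then have "card (edges H) \<le> (\<Sum>u\<in>?C. card (nbrs H u))"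
    using H fin by (intro card_edges_le_cover) auto
  also have "\<dots> \<le> card ?C * \<Delta>"
    using sum_bounded_above[of ?C "\<lambda>u. card (nbrs H u)" \<Delta>] deg_le by auto
  finally have le: "card (edges H) \<le> card ?C * \<Delta>" .
  have "n = card ?C + \<Delta>"
    using card_Diff_subset[OF finite_nbrs[OF H] nbrs_subset[OF H], of v]
      card_mono[OF fin nbrs_subset[OF H], of v] n v by simp
  moreover have "4 * (x * y) \<le> (x + y)\<^sup>2" for x y :: nat
  proof -
    have "int (4 * (x * y)) \<le> int ((x + y)\<^sup>2)"
      using zero_le_power2[of "int x - int y"] by (simp add: power2_eq_square algebra_simps)
    then show ?thesis by linarith
  qed
  ultimately have "4 * (card ?C * \<Delta>) \<le> n\<^sup>2"
    by simp
  then show ?thesis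
    using le by linarith
qed

section \<open>Graphs properly containing a star, and triangles\<close>

lemma properly_containing_star_if_edge_in_nbrs:
  assumes H: "simple_graph H" and k: "2 \<le> k" "k \<le> card (nbrs H v)"
    and ab: "a \<in> nbrs H v" "b \<in> nbrs H v" "{a, b} \<in> edges H"
  shows "\<exists>F. subgraph F H \<and> card (verts F) = card (verts (star k)) \<and>
             contains_copy_properly F (star k)"
proof -
  have "a \<noteq> b"
    using simple_graph_edgeD[OF H ab(3)] by simp
  then have "card {a, b} \<le> k" using k by simp
  then obtain S where S: "{a, b} \<subseteq> S" "S \<subseteq> nbrs H v" "card S = k"
    using exists_subset_between[of "{a, b}" k "nbrs H v"] finite_nbrs[OF H] k ab by auto
  have finS: "finite S"
    using S finite_nbrs[OF H] finite_subset by blast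
  have "v \<notin> nbrs H v"
    using simple_graph_edgeD(1)[OF H, of v v] by (auto simp: nbrs_iff)
  moreover have "v \<in> verts H"
    using ab simple_graph_edgeD(2)[OF H, of v a] by (simp add: nbrs_iff)
  ultimately have vS: "v \<notin> S" "v \<in> verts H" "S \<subseteq> verts H"
    using S nbrs_subset[OF H, of v] by auto
  \<comment> \<open>\<open>G'\<close> is the star with the centre \<open>v\<close> and the leaves \<open>S\<close>; \<open>F\<close> has the further edge
    \<open>{a, b}\<close>.\<close>
  define E where "E = (\<lambda>u. {v, u}) ` S"
  define G' where "G' = UGraph (insert v S) E"
  define F where "F = UGraph (insert v S) (insert {a, b} E)"
  have EH: "E \<subseteq> edges H"
    using S unfolding E_def by (auto simp: nbrs_iff)
  have E2: "E \<subseteq> nsets (insert v S) 2"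
    using vS unfolding E_def by auto
  have "{a, b} \<in> nsets (insert v S) 2"
    using S \<open>a \<noteq> b\<close> by auto
  then have F: "simple_graph F"
    using E2 finS by (simp add: simple_graph_def F_def)
  have "subgraph F H"
    unfolding subgraph_def using F H EH vS ab by (simp add: F_def)
  have "subgraph G' F"
    unfolding subgraph_def using F E2 finS by (auto simp: simple_graph_def G'_def F_def)
  moreover have "{a, b} \<notin> E"
    using vS S \<open>a \<noteq> b\<close> unfolding E_def by (auto simp: doubleton_eq_iff)
  then have "G' \<noteq> F"
    by (auto simp: G'_def F_def)
  moreover have "graph_iso (star k) G'"
  proof -
    obtain g where g: "bij_betw g {1..k} S"
      using finS S finite_same_card_bij[of "{1..k}" S] by auto
    define f where "f i = (if i = 0 then v else g i)" for i
    have "bij_betw f {1..k} S \<longleftrightarrow> bij_betw g {1..k} S"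
      by (rule bij_betw_cong) (simp add: f_def)
    then have f: "bij_betw f {1..k} S"
      using g by simp
    have "f ` {1..k} = S"
      using f by (simp add: bij_betw_def)
    have "{0..k} = insert 0 {1..k}" by auto
    moreover have "bij_betw f (insert 0 {1..k}) (insert v S)"
      using notIn_Un_bij_betw[of 0 "{1..k}" f S] f vS by (simp add: f_def)
    moreover have "(\<lambda>e. f ` e) ` (\<lambda>i. {0, i}) ` {1..k} = (\<lambda>u. {v, u}) ` f ` {1..k}"
      unfolding image_image by (intro image_cong) (auto simp: f_def)
    ultimately show ?thesis
      unfolding graph_iso_def star_def G'_def E_def
      using \<open>f ` {1..k} = S\<close> by (intro exI[of _ f]) simp
  qed
  ultimately have "contains_copy_properly F (star k)"
    unfolding contains_copy_properly_def by blast
  moreover have "card (verts F) = card (verts (star k))"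
    using S finS vS by (simp add: F_def star_def)
  ultimately show ?thesis
    using \<open>subgraph F H\<close> by blast
qed

lemma edge_in_nbrs_if_properly_containing_star:
  assumes F: "subgraph F H" and card_F: "card (verts F) = card (verts (star k))"
    and star: "contains_copy_properly F (star k)"
  obtains v a b where "k \<le> card (nbrs H v)" "a \<in> nbrs H v" "b \<in> nbrs H v" "{a, b} \<in> edges H"
proof -
  obtain G' f where G': "subgraph G' F" "G' \<noteq> F"
    and bij: "bij_betw f {0..k} (verts G')"
    and E: "(\<lambda>e. f ` e) ` (\<lambda>i. {0, i}) ` {1..k} = edges G'"
    using star unfolding contains_copy_properly_def graph_iso_def star_def by auto
  have simple: "simple_graph F" "simple_graph H" "edges F \<subseteq> edges H"
    using F by (auto simp: subgraph_def)
  define L where "L = f ` {1..k}"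
  have E': "edges G' = (\<lambda>u. {f 0, u}) ` L"
    unfolding E[symmetric] L_def by (simp add: image_image)
  have "{0..k} = insert 0 {1..k}" by auto
  then have V: "verts G' = insert (f 0) L"
    using bij unfolding L_def bij_betw_def by auto
  have "inj_on f {1..k}"
    using bij unfolding bij_betw_def by (auto intro: inj_on_subset)
  then have "card L = k"
    unfolding L_def by (simp add: card_image)
  have EF: "edges G' \<subseteq> edges F"
    using G' by (simp add: subgraph_def)
  have L: "L \<subseteq> nbrs H (f 0)"
    using subset_trans[OF EF simple(3)] unfolding E' by (force simp: nbrs_iff)
  have "card (verts G') = card (verts F)"
    using bij_betw_same_card[OF bij] card_F by (simp add: star_def)
  then have "verts G' = verts F"
    using G' simple by (intro card_subset_eq) (auto simp: subgraph_def simple_graph_def)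
  \<comment> \<open>\<open>F\<close> and the star have the same vertices, so they can only differ in their edges.\<close>
  then have "edges G' \<noteq> edges F"
    using G' by (metis ugraph.expand)
  then obtain e where e: "e \<in> edges F" "e \<notin> edges G'"
    using EF by auto
  then obtain a b where ab: "e = {a, b}" "a \<noteq> b" "a \<in> verts F" "b \<in> verts F"
    using simple_graph_edgeE simple by metis
  \<comment> \<open>An edge at the centre would already be an edge of the star.\<close>
  have "a \<in> L" "b \<in> L"
    using ab e E' V \<open>verts G' = verts F\<close> by (auto simp: insert_commute)
  moreover have "k \<le> card (nbrs H (f 0))"
    using card_mono[OF finite_nbrs[OF simple(2)] L] \<open>card L = k\<close> by simp
  ultimately show thesis
    using that[of "f 0" a b] L simple ab e by auto
qed

lemma star_admissible_iff:
  assumes "simple_graph H" "2 \<le> k"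
  shows "\<not> (\<exists>F. subgraph F H \<and> card (verts F) = card (verts (star k)) \<and>
                contains_copy_properly F (star k))
         \<longleftrightarrow> high_degree_indep (k - 1) H" (is "\<not> ?F \<longleftrightarrow> ?I")
proof
  assume "\<not> ?F"
  show ?I
    unfolding high_degree_indep_def
  proof (intro allI impI ballI notI)
    fix v a b
    assume "k - 1 < card (nbrs H v)" and ab: "a \<in> nbrs H v" "b \<in> nbrs H v" "{a, b} \<in> edges H"
    then have "k \<le> card (nbrs H v)"
      by linarith
    then show False
      using properly_containing_star_if_edge_in_nbrs[OF assms _ ab] \<open>\<not> ?F\<close> by blast
  qed
next
  assume ?I
  show "\<not> ?F"
  proof
    assume ?F
    then obtain F where "subgraph F H" "card (verts F) = card (verts (star k))"
      "contains_copy_properly F (star k)"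
      by blast
    then obtain v a b
      where "k \<le> card (nbrs H v)" "a \<in> nbrs H v" "b \<in> nbrs H v" "{a, b} \<in> edges H"
      by (rule edge_in_nbrs_if_properly_containing_star)
    moreover from this have "k - 1 < card (nbrs H v)"
      using assms by linarith
    ultimately show False
      using \<open>?I\<close> unfolding high_degree_indep_def by blast
  qed
qed

lemma contains_triangle_iff:
  assumes "simple_graph H"
  shows "contains_copy H (complete_graph 3) \<longleftrightarrow>
         (\<exists>a b c. {a, b} \<in> edges H \<and> {a, c} \<in> edges H \<and> {b, c} \<in> edges H)"
    (is "?L \<longleftrightarrow> ?R")
proof -
  have V3: "{..<3} = {0, 1, 2::nat}" by auto
  have E3: "nsets {..<3} 2 = {{0, 1}, {0, 2}, {1, 2::nat}}"
    unfolding V3 by (simp add: nsets_2_eq insert_Diff_if) auto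
  show ?thesis
  proof
    assume ?L
    then obtain G' f where G': "edges G' \<subseteq> edges H"
      and "(\<lambda>e. f ` e) ` nsets {..<3::nat} 2 = edges G'"
      unfolding contains_copy_def graph_iso_def subgraph_def complete_graph_def by auto
    then have "{f 0, f 1} \<in> edges H" "{f 0, f 2} \<in> edges H" "{f 1, f 2} \<in> edges H"
      unfolding E3 by auto
    then show ?R by blast
  next
    assume ?R
    then obtain a b c where e: "{a, b} \<in> edges H" "{a, c} \<in> edges H" "{b, c} \<in> edges H"
      by blast
    note d = simple_graph_edgeD[OF assms e(1)] simple_graph_edgeD[OF assms e(2)]
      simple_graph_edgeD[OF assms e(3)]
    define f :: "nat \<Rightarrow> 'a" where "f i = (if i = 0 then a else if i = 1 then b else c)" for i
    define G' where "G' = UGraph {a, b, c} {{a, b}, {a, c}, {b, c}}"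
    have f: "f 0 = a" "f 1 = b" "f 2 = c"
      by (simp_all add: f_def)
    have "bij_betw f {..<3} {a, b, c}"
      unfolding V3 using d f by (simp add: bij_betw_def)
    then have iso: "graph_iso (complete_graph 3) G'"
      unfolding graph_iso_def complete_graph_def G'_def ugraph.sel E3
      using f by (intro exI[of _ f]) simp
    have "subgraph G' H"
      using assms d e by (simp add: subgraph_def simple_graph_def G'_def)
    then show ?L
      unfolding contains_copy_def using iso by (intro exI conjI)
  qed
qed

lemma triangle_free_iff:
  assumes "simple_graph H"
  shows "\<not> contains_copy H (complete_graph 3) \<longleftrightarrow> high_degree_indep 0 H"
proof -
  have "0 < card (nbrs H v)" if "u \<in> nbrs H v" for u v
    using that finite_nbrs[OF assms] by (auto simp: card_gt_0_iff)
  then show ?thesis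
    unfolding contains_triangle_iff[OF assms] high_degree_indep_def
    by (metis nbrs_iff)
qed

lemma high_degree_indep_mono: "high_degree_indep d H \<Longrightarrow> d \<le> d' \<Longrightarrow> high_degree_indep d' H"
  unfolding high_degree_indep_def by (meson le_less_trans)

section \<open>Extremal graphs\<close>

text \<open>The balanced complete bipartite graph.\<close>

lemma ex_bipartite_graph:
  obtains H :: "nat ugraph"
  where "simple_graph H" "card (verts H) = n" "card (edges H) = n\<^sup>2 div 4" "high_degree_indep 0 H"
proof -
  define h where "h = n div 2"
  define E where "E = (\<lambda>(a, b). {a, b}) ` ({..<h} \<times> {h..<n})"
  define H where "H = UGraph {..<n} E"
  have "inj_on (\<lambda>(a, b). {a, b}) ({..<h} \<times> {h..<n})"
    by (auto simp: inj_on_def doubleton_eq_iff)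
  then have "card E = h * (n - h)"
    by (simp add: E_def card_image card_cartesian_product)
  also have "\<dots> = n\<^sup>2 div 4"
  proof (cases "even n")
    case True
    then obtain m where "n = 2 * m" by blast
    then show ?thesis by (simp add: h_def power2_eq_square)
  next
    case False
    then obtain m where m: "n = 2 * m + 1" using oddE by blast
    then have "n\<^sup>2 = 4 * (m * (m + 1)) + 1"
      by (simp add: power2_eq_square algebra_simps)
    then have "n\<^sup>2 div 4 = m * (m + 1)" by simp
    then show ?thesis using m by (simp add: h_def)
  qed
  finally have "card (edges H) = n\<^sup>2 div 4"
    by (simp add: H_def)
  moreover have "simple_graph H"
    by (auto simp: simple_graph_def H_def E_def h_def)
  moreover have "high_degree_indep 0 H"
  proof -
    have sides: "(a < h) \<noteq> (b < h)" if "{a, b} \<in> edges H" for a b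
      using that by (auto simp: H_def E_def doubleton_eq_iff)
    have "{a, b} \<notin> edges H" if "a \<in> nbrs H v" "b \<in> nbrs H v" for v a b
      using sides that unfolding nbrs_iff by blast
    then show ?thesis
      unfolding high_degree_indep_def by blast
  qed
  ultimately show thesis
    using that by (simp add: H_def)
qed

text \<open>The edges \<open>{i, i + j}\<close> of a circulant graph modulo \<open>n\<close> are different for different pairs of
  a vertex \<open>i\<close> and a difference \<open>j\<close> with \<open>0 < j < n / 2\<close>.\<close>

lemma inj_on_circulant:
  fixes h n :: nat
  assumes "2 * h < n"
  shows "inj_on (\<lambda>(i, j). {i, (i + j) mod n}) ({..<n} \<times> {1..h})"
proof (rule inj_onI)
  fix p q :: "nat \<times> nat"
  assume p: "p \<in> {..<n} \<times> {1..h}" and q: "q \<in> {..<n} \<times> {1..h}"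
    and eq: "(case p of (i, j) \<Rightarrow> {i, (i + j) mod n}) = (case q of (i, j) \<Rightarrow> {i, (i + j) mod n})"
  obtain i j i' j' where pq: "p = (i, j)" "q = (i', j')"
    by (cases p, cases q)
  then have ij: "i < n" "1 \<le> j" "j \<le> h" "i' < n" "1 \<le> j'" "j' \<le> h"
    using p q by simp_all
  have mod: "(a + b) mod n = a + b \<or> (a + b) mod n + n = a + b" if "a < n" "b \<le> h" for a b
    using that assms by (auto simp: mod_if)
  note m = mod[OF ij(1,3)] and m' = mod[OF ij(4,6)]
  have "{i, (i + j) mod n} = {i', (i' + j') mod n}"
    using eq pq by simp
  then consider "i = i'" "(i + j) mod n = (i' + j') mod n"
    | "i = (i' + j') mod n" "i' = (i + j) mod n"
    by (auto simp: doubleton_eq_iff)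
  then have "i = i' \<and> j = j'"
  proof cases
    case 1
    then show ?thesis using m m' ij assms by (elim disjE) linarith+
  next
    \<comment> \<open>Here \<open>j + j'\<close> would be a multiple of \<open>n\<close>, but \<open>0 < j + j' < n\<close>.\<close>
    case 2
    then show ?thesis using m m' ij assms by (elim disjE) linarith+
  qed
  then show "p = q"
    using pq by simp
qed

text \<open>A subgraph of the circulant graph modulo \<open>n\<close> with the differences \<open>1, \<dots>, h\<close>: of the edges
  \<open>{i, i + 1}\<close> with the difference 1, only those with \<open>i \<in> X\<close> are kept. It is the whole circulant
  graph for \<open>X = {..<n}\<close> and \<open>h \<ge> 1\<close>; other sets \<open>X\<close> leave room for a matching instead of the \<open>n\<close>-cycle.\<close>

definition circulant :: "nat \<Rightarrow> nat \<Rightarrow> nat set \<Rightarrow> nat ugraph" where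
  "circulant n h X =
     UGraph {..<n} ((\<lambda>(i, j). {i, (i + j) mod n}) ` ({..<n} \<times> {2..h} \<union> X \<times> {1}))"

lemma simple_graph_circulant:
  assumes "1 \<le> h" "2 * h < n" "X \<subseteq> {..<n}"
  shows "simple_graph (circulant n h X)"
proof -
  have "{i, (i + j) mod n} \<in> nsets {..<n} 2" if "i < n" "1 \<le> j" "j \<le> h" for i j
    using that assms by (auto simp: mod_if)
  moreover have "i < n" if "i \<in> X" for i
    using that assms(3) by auto
  ultimately have "(case p of (i, j) \<Rightarrow> {i, (i + j) mod n}) \<in> nsets {..<n} 2"
    if "p \<in> {..<n} \<times> {2..h} \<union> X \<times> {1}" for p
    using that assms(1) by (auto simp del: doubleton_in_nsets_2)
  then have "edges (circulant n h X) \<subseteq> nsets {..<n} 2"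
    unfolding circulant_def ugraph.sel by (rule image_subsetI)
  then show ?thesis
    by (simp add: simple_graph_def circulant_def)
qed

lemma card_edges_circulant:
  assumes "1 \<le> h" "2 * h < n" "X \<subseteq> {..<n}"
  shows "card (edges (circulant n h X)) = n * (h - 1) + card X"
proof -
  have "{..<n} \<times> {2..h} \<union> X \<times> {1} \<subseteq> {..<n} \<times> {1..h}"
    using assms by auto
  then have "card (edges (circulant n h X)) = card ({..<n} \<times> {2..h} \<union> X \<times> {1})"
    unfolding circulant_def ugraph.sel
    using inj_on_circulant[OF assms(2)] by (intro card_image) (rule inj_on_subset)
  also have "\<dots> = card ({..<n} \<times> {2..h}) + card (X \<times> {1::nat})"
    using assms finite_subset[OF assms(3)] by (intro card_Un_disjoint) auto
  finally show ?thesis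
    by (simp add: card_cartesian_product)
qed

lemma diff_mod_circulant:
  fixes i j n :: nat
  assumes "i < n" "j < n" "v = (i + j) mod n"
  shows "i = (v + n - j) mod n"
proof (cases "i + j < n")
  case True
  then show ?thesis using assms by simp
next
  case False
  then have "v = i + j - n"
    using assms by (simp add: mod_if)
  then show ?thesis
    using assms False by simp
qed

text \<open>Each difference \<open>2, \<dots>, h\<close> contributes at most two neighbours to a vertex \<open>v\<close>; the set \<open>U\<close>
  contains those that come from the difference 1.\<close>

lemma card_nbrs_circulant:
  assumes "2 * h < n" "finite U"
    and U: "v \<in> X \<Longrightarrow> (v + 1) mod n \<in> U"
           "\<And>i. i \<in> X \<Longrightarrow> (i + 1) mod n = v \<Longrightarrow> i \<in> U"
  shows "card (nbrs (circulant n h X) v) \<le> 2 * (h - 1) + card U"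
proof -
  let ?A = "(\<lambda>j. (v + j) mod n) ` {2..h}" and ?B = "(\<lambda>j. (v + n - j) mod n) ` {2..h}"
  have "nbrs (circulant n h X) v \<subseteq> ?A \<union> ?B \<union> U"
  proof
    fix u
    assume "u \<in> nbrs (circulant n h X) v"
    then obtain i j where e: "{v, u} = {i, (i + j) mod n}"
      and ij: "i < n \<and> j \<in> {2..h} \<or> i \<in> X \<and> j = 1"
      by (auto simp: nbrs_iff circulant_def)
    from e have vu: "v = i \<and> u = (i + j) mod n \<or> u = i \<and> v = (i + j) mod n"
      by (auto simp: doubleton_eq_iff)
    from ij show "u \<in> ?A \<union> ?B \<union> U"
    proof
      assume ij: "i < n \<and> j \<in> {2..h}"
      then have "i = ((i + j) mod n + n - j) mod n"
        using assms(1) by (intro diff_mod_circulant) auto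
      then have "u = (v + j) mod n \<or> u = (v + n - j) mod n"
        using vu by metis
      then show ?thesis
        using ij by blast
    next
      assume "i \<in> X \<and> j = 1"
      then show ?thesis
        using vu U by blast
    qed
  qed
  then have "card (nbrs (circulant n h X) v) \<le> card (?A \<union> ?B \<union> U)"
    using \<open>finite U\<close> by (intro card_mono) auto
  also have "\<dots> \<le> card ?A + card ?B + card U"
    using card_Un_le[of "?A \<union> ?B" U] card_Un_le[of ?A ?B] by linarith
  also have "\<dots> \<le> card {2..h} + card {2..h} + card U"
    by (intro add_mono card_image_le) auto
  finally show ?thesis by simp
qed

text \<open>The largest difference used is \<open>\<lceil>d / 2\<rceil>\<close>, and \<open>d + 2 \<le> n\<close> makes it less than \<open>n / 2\<close>.\<close>

lemma ex_bounded_degree_graph: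
  assumes "1 \<le> d" "d + 2 \<le> n"
  obtains H :: "nat ugraph"
  where "simple_graph H" "card (verts H) = n" "card (edges H) = d * n div 2"
    "\<And>v. card (nbrs H v) \<le> d"
proof (cases "even d")
  case True
  then obtain h where h: "d = 2 * h" by blast
  let ?H = "circulant n h {..<n}"
  have hn: "1 \<le> h" "2 * h < n" using assms h by auto
  have "card (nbrs ?H v) \<le> d" for v
  proof -
    let ?U = "{(v + 1) mod n, (v + n - 1) mod n}"
    have "i = ((i + 1) mod n + n - 1) mod n" if "i < n" for i
      using that hn by (intro diff_mod_circulant) auto
    then have "card (nbrs ?H v) \<le> 2 * (h - 1) + card ?U"
      using hn by (intro card_nbrs_circulant) auto
    moreover have "card ?U \<le> 2"
      by (simp add: card_insert_if)
    ultimately show ?thesis using h hn by linarith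
  qed
  moreover have "card (edges ?H) = d * n div 2"
    using card_edges_circulant[OF hn, of "{..<n}"] h hn by (cases h) auto
  ultimately show thesis
    using that simple_graph_circulant[OF hn, of "{..<n}"] by (simp add: circulant_def)
next
  case False
  then obtain m where m: "d = 2 * m + 1" using oddE by blast
  \<comment> \<open>Besides the differences \<open>2, \<dots>, m + 1\<close>, this graph has the edges \<open>{2 * t, 2 * t + 1}\<close>, which
    miss only the vertex \<open>n - 1\<close> if \<open>n\<close> is odd.\<close>
  let ?X = "(\<lambda>t. 2 * t) ` {..<n div 2}"
  let ?H = "circulant n (m + 1) ?X"
  have hn: "1 \<le> m + 1" "2 * (m + 1) < n" and X: "?X \<subseteq> {..<n}"
    using assms m by auto
  have "card (nbrs ?H v) \<le> d" for v
  proof -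
    \<comment> \<open>The only possible partner of \<open>v\<close> in the matching.\<close>
    let ?U = "{if even v then v + 1 else v - 1}"
    have "(2 * t + 1) mod n = 2 * t + 1" if "t < n div 2" for t
      using that by (intro mod_less) linarith
    then have "card (nbrs ?H v) \<le> 2 * (m + 1 - 1) + card ?U"
      using hn X by (intro card_nbrs_circulant) auto
    then show ?thesis using m by simp
  qed
  moreover have "card ?X = n div 2"
    by (simp add: card_image inj_on_def)
  then have "card (edges ?H) = n * m + n div 2"
    using card_edges_circulant[OF hn X] by simp
  moreover have "d * n div 2 = n * m + n div 2"
  proof -
    have "d * n = n + 2 * (n * m)" using m by (simp add: algebra_simps)
    then show ?thesis by simp
  qed
  ultimately show thesis
    using that simple_graph_circulant[OF hn X] by (simp add: circulant_def)
qed

section \<open>The extremal numbers\<close>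

lemma Max_Collect_nat_eqI:
  fixes m :: nat
  assumes "P m" "\<And>i. P i \<Longrightarrow> i \<le> m"
  shows "Max {m. P m} = m"
proof (rule Max_eqI)
  have "{m. P m} \<subseteq> {..m}"
    using assms(2) by auto
  then show "finite {m. P m}"
    by (rule finite_subset) simp
qed (use assms in auto)

text \<open>A graph that attains the bound of \<open>edges_bound\<close> for \<open>d = k - 1\<close> determines the number.\<close>

lemma st_number_starI:
  fixes H :: "nat ugraph"
  assumes k: "2 \<le> k"
    and H: "simple_graph H" "card (verts H) = n" "card (edges H) = m" "high_degree_indep (k - 1) H"
    and max: "max (n\<^sup>2) (2 * (k - 1) * n) div 4 \<le> m"
  shows "st_number n (star k) = m"
proof -
  let ?P = "\<lambda>m. \<exists>H :: nat ugraph. simple_graph H \<and> card (verts H) = n \<and> card (edges H) = m \<and>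
     \<not> (\<exists>F. subgraph F H \<and> card (verts F) = card (verts (star k)) \<and>
            contains_copy_properly F (star k))"
  show ?thesis
    unfolding st_number_def
  proof (rule Max_Collect_nat_eqI)
    show "?P m"
      by (intro exI[of _ H] conjI H(1,2,3) iffD2[OF star_admissible_iff[OF H(1) k] H(4)])
  next
    fix i
    assume P: "?P i"
    obtain H' :: "nat ugraph" where H': "simple_graph H'" "card (verts H') = n" "card (edges H') = i"
      and star: "\<not> (\<exists>F. subgraph F H' \<and> card (verts F) = card (verts (star k)) \<and>
                 contains_copy_properly F (star k))"
      using P by (elim exE conjE) (rule that)
    have "high_degree_indep (k - 1) H'"
      using star by (rule iffD1[OF star_admissible_iff[OF H'(1) k]])
    then have "4 * i \<le> max (n\<^sup>2) (2 * (k - 1) * n)"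
      using edges_bound[OF H'(1,2)] H'(3) by simp
    then show "i \<le> m" using max by linarith
  qed
qed

text \<open>This is Mantel's theorem, with the case \<open>d = 0\<close> of \<open>edges_bound\<close> as the upper bound.\<close>

lemma ex_number_triangle: "ex_number n (complete_graph 3) = n\<^sup>2 div 4"
proof -
  let ?P = "\<lambda>m. \<exists>H :: nat ugraph. simple_graph H \<and> card (verts H) = n \<and> card (edges H) = m \<and>
     \<not> contains_copy H (complete_graph 3)"
  show ?thesis
    unfolding ex_number_def
  proof (rule Max_Collect_nat_eqI)
    obtain H :: "nat ugraph" where H: "simple_graph H" "card (verts H) = n"
      "card (edges H) = n\<^sup>2 div 4" "high_degree_indep 0 H"
      by (rule ex_bipartite_graph)
    then show "?P (n\<^sup>2 div 4)"
      using triangle_free_iff[OF H(1)] by (intro exI[of _ H]) simp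
  next
    fix i
    assume P: "?P i"
    obtain H' :: "nat ugraph" where H': "simple_graph H'" "card (verts H') = n" "card (edges H') = i"
      and triangle: "\<not> contains_copy H' (complete_graph 3)"
      using P by (elim exE conjE) (rule that)
    have "high_degree_indep 0 H'"
      using triangle triangle_free_iff[OF H'(1)] by simp
    then have "4 * i \<le> max (n\<^sup>2) (2 * 0 * n)"
      using edges_bound[OF H'(1,2)] H'(3) by blast
    then show "i \<le> n\<^sup>2 div 4" by simp
  qed
qed

theorem theorem11:
  fixes k n :: nat
  assumes "k \<ge> 2"
  shows "(n \<ge> 2 * k - 1 \<and> n \<ge> k + 1 \<longrightarrow>
            st_number n (star k) = n\<^sup>2 div 4 \<and> n\<^sup>2 div 4 = ex_number n (complete_graph 3))
       \<and> (k + 1 \<le> n \<and> n \<le> 2 * k - 2 \<longrightarrow>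
            st_number n (star k) = (k - 1) * n div 2)"
proof (intro conjI impI)
  assume n: "n \<ge> 2 * k - 1 \<and> n \<ge> k + 1"
  obtain H :: "nat ugraph" where H: "simple_graph H" "card (verts H) = n"
    "card (edges H) = n\<^sup>2 div 4" "high_degree_indep 0 H"
    by (rule ex_bipartite_graph)
  have "2 * (k - 1) \<le> n" using n by linarith
  then have "2 * (k - 1) * n \<le> n\<^sup>2"
    unfolding power2_eq_square by (rule mult_right_mono) simp
  then show "st_number n (star k) = n\<^sup>2 div 4"
    using assms H high_degree_indep_mono[OF H(4)] by (intro st_number_starI[of k H]) auto
  show "n\<^sup>2 div 4 = ex_number n (complete_graph 3)"
    by (simp add: ex_number_triangle)
next
  assume n: "k + 1 \<le> n \<and> n \<le> 2 * k - 2"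
  have "1 \<le> k - 1" "k - 1 + 2 \<le> n"
    using assms n by linarith+
  then obtain H :: "nat ugraph" where H: "simple_graph H" "card (verts H) = n"
    "card (edges H) = (k - 1) * n div 2" "\<And>v. card (nbrs H v) \<le> k - 1"
    by (rule ex_bounded_degree_graph) blast
  have "n \<le> 2 * (k - 1)" using n by linarith
  then have "n\<^sup>2 \<le> 2 * (k - 1) * n"
    unfolding power2_eq_square by (rule mult_right_mono) simp
  then have "max (n\<^sup>2) (2 * (k - 1) * n) div 4 \<le> (k - 1) * n div 2"
    by (simp add: max_absorb2 mult.assoc mult.commute)
  moreover have "high_degree_indep (k - 1) H"
    unfolding high_degree_indep_def using H(4) leD by blast
  ultimately show "st_number n (star k) = (k - 1) * n div 2"
    using assms H by (intro st_number_starI[of k H]) auto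
qed

end
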